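(* Let $G$ be a topological group and let $\mathcal{N}$ be a filter-base of $h$-complete normal subgroups of $G$. Suppose that $G$ naturally embeds into the product $P = \prod_{N \in \mathcal{N}} G/N$, that is, the canonical homomorphism $G \to P$, $g \mapsto (gN)_{N \in \mathcal{N}}$, is a topological embedding. Then: if each quotient $G/N$ ($N \in \mathcal{N}$) is minimal, then $G$ is minimal; and if each quotient $G/N$ ($N \in \mathcal{N}$) is totally minimal, then $G$ is totally minimal.
   Context: All topological groups are assumed to be Hausdorff. A topological group $G$ is $h$-complete if for every continuous homomorphism $\varphi: G \rightarrow L$ into a topological group $L$, the image $\varphi(G)$ is closed in $L$. A filter-base of subgroups is a non-empty family $\mathcal{N}$ such that for all $N_1, N_2 \in \mathcal{N}$ there is $N \in \mathcal{N}$ with $N \subseteq N_1 \cap N_2$. A topological group is minimal if it does not admit a strictly coarser (Hausdorff) group topology. A topological group $G$ is totally minimal if every continuous surjective homomorphism $\varphi: G \rightarrow H$ onto a topological group $H$ is open; equivalently, if every (Hausdorff) quotient of $G$ is minimal. *)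

theory Defs
  imports "HOL-Analysis.Analysis" "HOL-Algebra.Coset" "HOL-Algebra.Generated_Groups"
begin

text \<open>Following the paper's standing assumption, the Hausdorff axiom is part of the notion.\<close>

locale topological_group = group G for G :: "('a, 'm) monoid_scheme" (structure) +
  fixes T :: "'a topology"
  assumes topspace_eq: "topspace T = carrier G"
    and continuous_mult: "continuous_map (prod_topology T T) T (\<lambda>(x, y). x \<otimes> y)"
    and continuous_inv: "continuous_map T T (\<lambda>x. inv x)"
    and Hausdorff: "Hausdorff_space T"

definition quotient_topology :: "'a topology \<Rightarrow> ('a \<Rightarrow> 'b) \<Rightarrow> 'b topology" where
  "quotient_topology X q =
     topology (\<lambda>U. U \<subseteq> q ` topspace X \<and> openin X {x \<in> topspace X. q x \<in> U})"

text \<open>The topology of \<open>G Mod N\<close>; its points are the cosets \<open>N #> g\<close>.\<close>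

definition factor_topology ::
    "('a, 'm) monoid_scheme \<Rightarrow> 'a topology \<Rightarrow> 'a set \<Rightarrow> 'a set topology" where
  "factor_topology G T N = quotient_topology T (\<lambda>g. N #>\<^bsub>G\<^esub> g)"

text \<open>HOL cannot quantify over all types inside a definition, so in \<open>h_complete\<close> and
  \<open>totally_minimal\<close> the target group has its carrier in the same type as \<open>G\<close>. This is no
  restriction: the lemmas \<open>h_complete_any_type\<close> and \<open>totally_minimal_any_type\<close> below derive
  the same property for targets over an arbitrary type.\<close>

definition h_complete :: "('a, 'm) monoid_scheme \<Rightarrow> 'a topology \<Rightarrow> bool" where
  "h_complete G T \<longleftrightarrow>
     (\<forall>(L :: 'a monoid) T'. topological_group L T' \<longrightarrow>
        (\<forall>\<phi> \<in> hom G L. continuous_map T T' \<phi> \<longrightarrow> closedin T' (\<phi> ` carrier G)))"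

definition minimal_group :: "('a, 'm) monoid_scheme \<Rightarrow> 'a topology \<Rightarrow> bool" where
  "minimal_group G T \<longleftrightarrow>
     \<not> (\<exists>T'. topological_group G T' \<and> (\<forall>U. openin T' U \<longrightarrow> openin T U) \<and> T' \<noteq> T)"

definition totally_minimal :: "('a, 'm) monoid_scheme \<Rightarrow> 'a topology \<Rightarrow> bool" where
  "totally_minimal G T \<longleftrightarrow>
     (\<forall>(H :: 'a monoid) T'. topological_group H T' \<longrightarrow>
        (\<forall>\<phi> \<in> hom G H. continuous_map T T' \<phi> \<and> \<phi> ` carrier G = carrier H
           \<longrightarrow> open_map T T' \<phi>))"

definition subgroup_filter_base :: "('a, 'm) monoid_scheme \<Rightarrow> 'a set set \<Rightarrow> bool" where
  "subgroup_filter_base G \<N> \<longleftrightarrow>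
     \<N> \<noteq> {} \<and> (\<forall>N \<in> \<N>. subgroup N G) \<and>
     (\<forall>N\<^sub>1 \<in> \<N>. \<forall>N\<^sub>2 \<in> \<N>. \<exists>N \<in> \<N>. N \<subseteq> N\<^sub>1 \<inter> N\<^sub>2)"

subsection \<open>The quotient topology\<close>

lemma openin_quotient_topology:
  "openin (quotient_topology X q) U \<longleftrightarrow>
     U \<subseteq> q ` topspace X \<and> openin X {x \<in> topspace X. q x \<in> U}"
proof -
  have "istopology (\<lambda>U. U \<subseteq> q ` topspace X \<and> openin X {x \<in> topspace X. q x \<in> U})"
    unfolding istopology_def
  proof (intro conjI allI impI)
    fix S T
    assume ST: "S \<subseteq> q ` topspace X \<and> openin X {x \<in> topspace X. q x \<in> S}"
      "T \<subseteq> q ` topspace X \<and> openin X {x \<in> topspace X. q x \<in> T}"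
    have eq: "{x \<in> topspace X. q x \<in> S \<inter> T} =
        {x \<in> topspace X. q x \<in> S} \<inter> {x \<in> topspace X. q x \<in> T}" by auto
    show "openin X {x \<in> topspace X. q x \<in> S \<inter> T}"
      unfolding eq using ST by (intro openin_Int) simp_all
    show "S \<inter> T \<subseteq> q ` topspace X" using ST by blast
  next
    fix \<K>
    assume \<K>: "\<forall>K\<in>\<K>. K \<subseteq> q ` topspace X \<and> openin X {x \<in> topspace X. q x \<in> K}"
    have eq: "{x \<in> topspace X. q x \<in> \<Union>\<K>} = (\<Union>K\<in>\<K>. {x \<in> topspace X. q x \<in> K})" by auto
    show "openin X {x \<in> topspace X. q x \<in> \<Union>\<K>}"
      unfolding eq using \<K> by (intro openin_Union) auto
    show "\<Union>\<K> \<subseteq> q ` topspace X" using \<K> by blast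
  qed
  then show ?thesis
    by (simp only: quotient_topology_def topology_inverse')
qed

lemma topspace_quotient_topology [simp]: "topspace (quotient_topology X q) = q ` topspace X"
proof (rule antisym)
  show "topspace (quotient_topology X q) \<subseteq> q ` topspace X"
    using openin_topspace[of "quotient_topology X q"] unfolding openin_quotient_topology by (rule conjunct1)
  have "{x \<in> topspace X. q x \<in> q ` topspace X} = topspace X" by blast
  then have "openin (quotient_topology X q) (q ` topspace X)"
    by (simp add: openin_quotient_topology)
  then show "q ` topspace X \<subseteq> topspace (quotient_topology X q)"
    by (rule openin_subset)
qed

lemma quotient_map_quotient_topology: "quotient_map X (quotient_topology X q) q"
  by (auto simp: quotient_map_def openin_quotient_topology)

lemma (in topological_group) topspace_factor_topology:
  "topspace (factor_topology G T N) = carrier (G Mod N)"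
  by (auto simp: factor_topology_def topspace_eq FactGroup_def RCOSETS_def)

subsection \<open>Independence of the type of the target group\<close>

lemma topological_group_transport:
  fixes L :: "('b, 'm) monoid_scheme" and f :: "'b \<Rightarrow> 'a"
  assumes L: "topological_group L T" and inj: "inj_on f (carrier L)"
  obtains L' :: "'a monoid" and T' :: "'a topology"
  where "topological_group L' T'" "f \<in> iso L L'" "homeomorphic_map T T' f"
proof -
  interpret L: topological_group L T by (rule L)
  define g where "g = inv_into (carrier L) f"
  have gf [simp]: "g (f x) = x" if "x \<in> carrier L" for x
    using that inj by (simp add: g_def)
  define L' :: "'a monoid" where
    "L' = \<lparr>carrier = f ` carrier L, mult = (\<lambda>x y. f (g x \<otimes>\<^bsub>L\<^esub> g y)), one = f \<one>\<^bsub>L\<^esub>\<rparr>"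
  define T' where "T' = pullback_topology (f ` carrier L) g T"
  have carr: "carrier L' = f ` carrier L"
    by (simp add: L'_def)
  have mult: "f x \<otimes>\<^bsub>L'\<^esub> f y = f (x \<otimes>\<^bsub>L\<^esub> y)" if "x \<in> carrier L" "y \<in> carrier L" for x y
    using that by (simp add: L'_def)
  have one: "\<one>\<^bsub>L'\<^esub> = f \<one>\<^bsub>L\<^esub>"
    by (simp add: L'_def)
  have grp: "group L'"
  proof (rule groupI)
    fix x assume "x \<in> carrier L'"
    then obtain a where a: "a \<in> carrier L" "x = f a" by (auto simp: carr)
    then have "f (inv\<^bsub>L\<^esub> a) \<otimes>\<^bsub>L'\<^esub> x = \<one>\<^bsub>L'\<^esub>" by (simp add: mult one)
    then show "\<exists>y\<in>carrier L'. y \<otimes>\<^bsub>L'\<^esub> x = \<one>\<^bsub>L'\<^esub>" using a by (auto simp: carr)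
  qed (auto simp: carr mult one L.m_assoc)
  have iso: "f \<in> iso L L'"
    using inj by (auto simp: iso_def hom_def bij_betw_def carr mult)
  have inv: "inv\<^bsub>L'\<^esub> f x = f (inv\<^bsub>L\<^esub> x)" if "x \<in> carrier L" for x
  proof -
    have "f \<in> hom L L'" using iso by (simp add: iso_def)
    then interpret group_hom L L' f
      by (simp add: group_hom_def group_hom_axioms_def grp L.group_axioms)
    show ?thesis using that by (simp add: hom_inv)
  qed
  have top: "topspace T' = f ` carrier L"
    unfolding T'_def topspace_pullback_topology using L.topspace_eq by auto
  have cg: "continuous_map T' T g"
    unfolding T'_def using continuous_map_pullback[OF continuous_map_id] by simp
  have cf: "continuous_map T T' f"
    unfolding T'_def
  proof (rule continuous_map_pullback')
    show "continuous_map T T (g \<circ> f)"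
      by (rule continuous_map_eq[OF continuous_map_id]) (simp add: L.topspace_eq)
  qed (simp add: L.topspace_eq vimage_def, blast)
  have hm: "homeomorphic_maps T T' f g"
    using cf cg by (auto simp: homeomorphic_maps_def L.topspace_eq top)
  have "topological_group L' T'"
  proof (intro topological_group.intro[OF grp] topological_group_axioms.intro)
    show "topspace T' = carrier L'" by (simp add: top carr)
    have "continuous_map (prod_topology T' T') (prod_topology T T) (\<lambda>z. (g (fst z), g (snd z)))"
      by (intro continuous_map_paired[THEN iffD2] conjI
          continuous_map_compose[OF continuous_map_fst cg, unfolded o_def]
          continuous_map_compose[OF continuous_map_snd cg, unfolded o_def])
    from continuous_map_compose[OF continuous_map_compose[OF this L.continuous_mult] cf]
    show "continuous_map (prod_topology T' T') T' (\<lambda>(x, y). x \<otimes>\<^bsub>L'\<^esub> y)"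
      by (rule continuous_map_eq) (auto simp: top mult)
    from continuous_map_compose[OF continuous_map_compose[OF cg L.continuous_inv] cf]
    show "continuous_map T' T' (\<lambda>x. inv\<^bsub>L'\<^esub> x)"
      by (rule continuous_map_eq) (auto simp: top inv)
    show "Hausdorff_space T'"
      using hm L.Hausdorff homeomorphic_Hausdorff_space homeomorphic_space_def by blast
  qed
  moreover have "homeomorphic_map T T' f"
    using hm homeomorphic_map_maps by blast
  ultimately show thesis using that iso by blast
qed

lemma topological_group_subgroup:
  assumes L: "topological_group L T" and K: "subgroup K L"
  shows "topological_group (L\<lparr>carrier := K\<rparr>) (subtopology T K)"
proof -
  interpret L: topological_group L T by (rule L)
  have sub: "K \<subseteq> carrier L" using K by (rule subgroup.subset)
  have grp: "group (L\<lparr>carrier := K\<rparr>)"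
    using K L.group_axioms by (rule subgroup.subgroup_is_group)
  show ?thesis
  proof (intro topological_group.intro[OF grp] topological_group_axioms.intro)
    show "topspace (subtopology T K) = carrier (L\<lparr>carrier := K\<rparr>)"
      using sub by (auto simp: L.topspace_eq)
    show "Hausdorff_space (subtopology T K)"
      using L.Hausdorff by (rule Hausdorff_space_subtopology)
    have "continuous_map (subtopology (prod_topology T T) (K \<times> K)) T (\<lambda>(x, y). x \<otimes>\<^bsub>L\<^esub> y)"
      by (rule continuous_map_from_subtopology[OF L.continuous_mult])
    then show "continuous_map (prod_topology (subtopology T K) (subtopology T K)) (subtopology T K)
        (\<lambda>(x, y). x \<otimes>\<^bsub>L\<lparr>carrier := K\<rparr>\<^esub> y)"
      using K by (auto simp: subtopology_Times [symmetric] continuous_map_in_subtopology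
          subgroup.m_closed)
    have inv: "inv\<^bsub>L\<lparr>carrier := K\<rparr>\<^esub> x = inv\<^bsub>L\<^esub> x" if "x \<in> K" for x
      using K that by (rule L.m_inv_consistent)
    have "continuous_map (subtopology T K) T (\<lambda>x. inv\<^bsub>L\<^esub> x)"
      by (rule continuous_map_from_subtopology[OF L.continuous_inv])
    then have "continuous_map (subtopology T K) (subtopology T K) (\<lambda>x. inv\<^bsub>L\<^esub> x)"
      using K by (auto simp: continuous_map_in_subtopology subgroup.m_inv_closed)
    then show "continuous_map (subtopology T K) (subtopology T K)
        (\<lambda>x. inv\<^bsub>L\<lparr>carrier := K\<rparr>\<^esub> x)"
      by (rule continuous_map_eq) (simp add: inv)
  qed
qed

lemma totally_minimal_any_type:
  fixes G :: "('a, 'm) monoid_scheme" and H :: "('b, 'n) monoid_scheme"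
  assumes G: "topological_group G T" and tm: "totally_minimal G T"
    and H: "topological_group H T'" and hom: "\<phi> \<in> hom G H"
    and cont: "continuous_map T T' \<phi>" and surj: "\<phi> ` carrier G = carrier H"
  shows "open_map T T' \<phi>"
proof -
  define f where "f = inv_into (carrier G) \<phi>"
  have "inj_on f (carrier H)"
    unfolding f_def surj[symmetric] by (rule inj_on_inv_into) simp
  then obtain H' :: "'a monoid" and T'' where H': "topological_group H' T''"
    and iso: "f \<in> iso H H'" and hm: "homeomorphic_map T' T'' f"
    using topological_group_transport[OF H] by metis
  have "f \<circ> \<phi> \<in> hom G H'"
    using hom iso by (auto simp: iso_def intro: hom_compose)
  moreover have "continuous_map T T'' (f \<circ> \<phi>)"
    by (rule continuous_map_compose[OF cont homeomorphic_imp_continuous_map[OF hm]])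
  moreover have "(f \<circ> \<phi>) ` carrier G = carrier H'"
    using surj iso unfolding image_comp [symmetric] by (simp add: iso_def bij_betw_def)
  ultimately have op: "open_map T T'' (f \<circ> \<phi>)"
    using tm H' unfolding totally_minimal_def by blast
  obtain g where g: "homeomorphic_maps T' T'' f g"
    using hm homeomorphic_map_maps by blast
  then have "open_map T'' T' g"
    by (auto simp: homeomorphic_maps_map intro: homeomorphic_imp_open_map)
  with op have "open_map T T' (g \<circ> (f \<circ> \<phi>))"
    by (rule open_map_compose)
  moreover have "(g \<circ> (f \<circ> \<phi>)) x = \<phi> x" if "x \<in> topspace T" for x
    using g that cont by (auto simp: homeomorphic_maps_def continuous_map_def)
  ultimately show ?thesis
    by (rule open_map_eq)
qed

lemma card_of_generate_ordLeq:
  fixes L :: "('b, 'n) monoid_scheme" and A :: "'a set"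
  assumes "infinite A" and S: "(card_of S, card_of A) \<in> ordLeq"
  shows "(card_of (generate L S), card_of A) \<in> ordLeq"
proof -
  define M where
    "M = rec_nat (insert \<one>\<^bsub>L\<^esub> (S \<union> m_inv L ` S)) (\<lambda>_ X. X \<union> (\<lambda>(x, y). x \<otimes>\<^bsub>L\<^esub> y) ` (X \<times> X))"
  have M0: "M 0 = insert \<one>\<^bsub>L\<^esub> (S \<union> m_inv L ` S)"
    and MS: "M (Suc n) = M n \<union> (\<lambda>(x, y). x \<otimes>\<^bsub>L\<^esub> y) ` (M n \<times> M n)" for n
    unfolding M_def by (simp_all only: nat.rec)
  have mono: "M m \<subseteq> M n" if "m \<le> n" for m n
    by (rule lift_Suc_mono_le[of M, OF _ that]) (simp add: MS)
  have base: "y \<in> (\<Union>n. M n)" if "y \<in> insert \<one>\<^bsub>L\<^esub> (S \<union> m_inv L ` S)" for y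
    by (rule UN_I[of 0]) (simp_all only: M0 that UNIV_I)
  have "x \<in> (\<Union>n. M n)" if "x \<in> generate L S" for x
    using that
  proof induction
    case (eng h1 h2)
    then obtain m n where "h1 \<in> M m" "h2 \<in> M n" by auto
    then have "h1 \<in> M (max m n)" "h2 \<in> M (max m n)"
      using mono[of m "max m n"] mono[of n "max m n"] by auto
    then have "h1 \<otimes>\<^bsub>L\<^esub> h2 \<in> M (Suc (max m n))"
      by (auto simp: MS)
    then show ?case by (rule UN_I[OF UNIV_I])
  qed (use base in auto)
  then have sub: "generate L S \<subseteq> (\<Union>n. M n)" by blast
  have im: "(card_of (h ` X), card_of A) \<in> ordLeq" if "(card_of X, card_of A) \<in> ordLeq"
    for h :: "'c \<Rightarrow> 'b" and X
    using card_of_image that by (rule ordLeq_transitive)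
  have un: "(card_of (X \<union> Y), card_of A) \<in> ordLeq"
    if "(card_of X, card_of A) \<in> ordLeq" "(card_of Y, card_of A) \<in> ordLeq" for X Y :: "'b set"
    by (rule card_of_Un_ordLeq_infinite_Field)
      (use that \<open>infinite A\<close> in \<open>simp_all add: Field_card_of card_of_card_order_on\<close>)
  have "(card_of (M n), card_of A) \<in> ordLeq" for n
  proof (induction n)
    case 0
    have "(card_of {\<one>\<^bsub>L\<^esub>}, card_of A) \<in> ordLeq"
      using \<open>infinite A\<close> by (simp add: card_of_singl_ordLeq infinite_imp_nonempty)
    then have "(card_of ({\<one>\<^bsub>L\<^esub>} \<union> (S \<union> m_inv L ` S)), card_of A) \<in> ordLeq"
      by (rule un[OF _ un[OF S im[OF S]]])
    then show ?case
      by (simp add: M0)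
  next
    case (Suc n)
    then have "(card_of (M n \<times> M n), card_of A) \<in> ordLeq"
      by (intro card_of_Times_ordLeq_infinite_Field)
        (use \<open>infinite A\<close> in \<open>simp_all add: Field_card_of card_of_card_order_on\<close>)
    then show ?case
      unfolding MS by (rule un[OF Suc.IH im])
  qed
  moreover have "(card_of (UNIV :: nat set), card_of A) \<in> ordLeq"
    using \<open>infinite A\<close> by (simp add: infinite_iff_card_of_nat)
  ultimately have "(card_of (\<Union>n. M n), card_of A) \<in> ordLeq"
    by (intro card_of_UNION_ordLeq_infinite[OF \<open>infinite A\<close>]) auto
  with card_of_mono1[OF sub] show ?thesis
    by (rule ordLeq_transitive)
qed

lemma h_complete_any_type:
  fixes G :: "('a, 'm) monoid_scheme" and L :: "('b, 'n) monoid_scheme"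
  assumes G: "topological_group G T" and hc: "h_complete G T"
    and L: "topological_group L T'" and hom: "\<phi> \<in> hom G L" and cont: "continuous_map T T' \<phi>"
  shows "closedin T' (\<phi> ` carrier G)"
proof (rule ccontr)
  interpret G: topological_group G T by (rule G)
  interpret L: topological_group L T' by (rule L)
  let ?S = "\<phi> ` carrier G"
  assume ncl: "\<not> closedin T' ?S"
  have S: "?S \<subseteq> carrier L"
    using hom by (auto simp: hom_def)
  have inf: "infinite ?S"
    using ncl S L.Hausdorff closedin_Hausdorff_finite L.topspace_eq by metis
  then have infG: "infinite (carrier G)" by blast
  have "\<not> Abstract_Topology.closure_of T' ?S \<subseteq> ?S"
    using ncl S L.topspace_eq closure_of_subset_eq by metis
  then obtain x where x: "x \<in> Abstract_Topology.closure_of T' ?S" "x \<notin> ?S" by blast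
  then have xL: "x \<in> carrier L"
    using closure_of_subset_topspace L.topspace_eq by fast
  define K where "K = generate L (insert x ?S)"
  have K: "subgroup K L"
    unfolding K_def using S xL by (intro L.generate_is_subgroup) auto
  have SK: "insert x ?S \<subseteq> K"
    unfolding K_def by (auto intro: generate.incl)
  have KL: "K \<subseteq> carrier L" using K by (rule subgroup.subset)
  have "(card_of (insert x ?S), card_of ?S) \<in> ordLeq"
    using inf infinite_insert_eqpoll[of ?S x] ordIso_imp_ordLeq
    by (auto simp: eqpoll_iff_card_of_ordIso)
  then have "(card_of (insert x ?S), card_of (carrier G)) \<in> ordLeq"
    using card_of_image by (rule ordLeq_transitive)
  then have "(card_of K, card_of (carrier G)) \<in> ordLeq"
    unfolding K_def by (rule card_of_generate_ordLeq[OF infG])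
  then obtain f where f: "inj_on f K" "f ` K \<subseteq> carrier G"
    unfolding card_of_ordLeq [symmetric] by auto
  let ?LK = "L\<lparr>carrier := K\<rparr>" and ?TK = "subtopology T' K"
  have LK: "topological_group ?LK ?TK"
    using L K by (rule topological_group_subgroup)
  obtain L2 :: "'a monoid" and T2 where L2: "topological_group L2 T2"
    and iso: "f \<in> iso ?LK L2" and hm: "homeomorphic_map ?TK T2 f"
    using topological_group_transport[OF LK, of f] f by auto
  have "\<phi> \<in> hom G ?LK"
    using hom SK by (auto simp: hom_def)
  then have "f \<circ> \<phi> \<in> hom G L2"
    using iso by (auto simp: iso_def intro: hom_compose)
  moreover have "continuous_map T ?TK \<phi>"
    using cont SK by (auto simp: continuous_map_in_subtopology G.topspace_eq)
  then have "continuous_map T T2 (f \<circ> \<phi>)"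
    by (rule continuous_map_compose[OF _ homeomorphic_imp_continuous_map[OF hm]])
  ultimately have "closedin T2 ((f \<circ> \<phi>) ` carrier G)"
    using hc L2 unfolding h_complete_def by blast
  then have "closedin T2 (f ` ?S)"
    by (simp only: image_comp)
  moreover have "?S \<subseteq> topspace ?TK"
    using SK KL by (auto simp: L.topspace_eq)
  ultimately have "closedin ?TK ?S"
    using homeomorphic_map_closedness_eq[OF hm] by blast
  then obtain C where C: "closedin T' C" "?S = C \<inter> K"
    by (auto simp: closedin_subtopology)
  then have "x \<in> C"
    using x closure_of_minimal[of ?S C T'] by blast
  then show False
    using x C SK by blast
qed

end

theory Submission
  imports Defs
begin

text \<open>Write \<open>q\<^sub>N\<close> for the projection \<open>G \<rightarrow> G/N\<close>. The embedding into the product says that the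
  topology of \<open>G\<close> is the initial one for the maps \<open>q\<^sub>N\<close>, and since \<open>\<N>\<close> is a filter base, any
  finitely many of these maps factor through a single one. So the open sets that are unions of
  cosets of some \<open>N \<in> \<N>\<close> form a base of \<open>G\<close> (\<open>saturated_open_neighbourhood\<close>).

  Let \<open>\<phi>\<close> be a continuous homomorphism from \<open>G\<close> onto \<open>H\<close>. If \<open>U\<close> is open and \<open>N\<close>-saturated, then
  \<open>\<phi>(U)\<close> is the preimage in \<open>H\<close> of the image of \<open>q\<^sub>N(U)\<close> under the induced map
  \<open>G/N \<rightarrow> H/\<phi>(N)\<close>. Hence \<open>\<phi>\<close> is open as soon as all these induced maps are open
  (\<open>open_map_if_induced_maps_open\<close>).

  The hypothesis of \<open>h\<close>-completeness is what makes \<open>\<phi>(N)\<close> closed, so that \<open>H/\<phi>(N)\<close> is Hausdorff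
  and competes in the definitions of minimality and total minimality of \<open>G/N\<close>. Total minimality
  then says directly that the induced maps are open. For minimality, \<open>\<phi>\<close> is the identity from
  \<open>G\<close> to \<open>G\<close> with a coarser topology, and the induced maps are the identities from \<open>G/N\<close> to
  \<open>G/N\<close> with a coarser group topology.\<close>

section \<open>Quotients of topological groups\<close>

lemma open_map_prod_topology:
  assumes f: "open_map X X' f" and g: "open_map Y Y' g"
  shows "open_map (prod_topology X Y) (prod_topology X' Y') (\<lambda>(x, y). (f x, g y))"
  unfolding open_map_def
proof (intro allI impI)
  fix W assume W: "openin (prod_topology X Y) W"
  show "openin (prod_topology X' Y') ((\<lambda>(x, y). (f x, g y)) ` W)"
    unfolding openin_prod_topology_alt
  proof (intro allI impI)
    fix a b assume "(a, b) \<in> (\<lambda>(x, y). (f x, g y)) ` W"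
    then obtain x y where xy: "(x, y) \<in> W" "a = f x" "b = g y" by auto
    then obtain U V where UV: "openin X U" "openin Y V" "x \<in> U" "y \<in> V" "U \<times> V \<subseteq> W"
      using W unfolding openin_prod_topology_alt by meson
    have "f ` U \<times> g ` V \<subseteq> (\<lambda>(x, y). (f x, g y)) ` W"
      using UV(5) by force
    with UV f g xy show "\<exists>U V. openin X' U \<and> openin Y' V \<and> a \<in> U \<and> b \<in> V \<and>
        U \<times> V \<subseteq> (\<lambda>(x, y). (f x, g y)) ` W"
      unfolding open_map_def by blast
  qed
qed

context topological_group
begin

lemma continuous_map_translation:
  assumes a: "a \<in> carrier G"
  shows "continuous_map T T (\<lambda>x. a \<otimes> x)"
proof -
  have "continuous_map T (prod_topology T T) (\<lambda>x. (a, x))"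
    using a by (auto simp: continuous_map_paired topspace_eq)
  from continuous_map_compose[OF this continuous_mult] show ?thesis
    by (simp add: o_def)
qed

lemma quotient_map_coset: "quotient_map T (factor_topology G T N) (\<lambda>g. N #> g)"
  unfolding factor_topology_def by (rule quotient_map_quotient_topology)

lemma continuous_map_coset: "continuous_map T (factor_topology G T N) (\<lambda>g. N #> g)"
  by (rule quotient_imp_continuous_map[OF quotient_map_coset])

lemma coset_eq_iff:
  assumes N: "subgroup N G" and x: "x \<in> carrier G" and y: "y \<in> carrier G"
  shows "N #> x = N #> y \<longleftrightarrow> x \<otimes> inv y \<in> N"
proof -
  have "x \<otimes> inv y \<in> N \<longleftrightarrow> x \<in> N #> y"
    using subgroup.rcos_module[OF N group_axioms y x] by simp
  also have "\<dots> \<longleftrightarrow> N #> x = N #> y"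
    using N x y repr_independence rcos_self by metis
  finally show ?thesis by simp
qed

text \<open>The saturation \<open>NU\<close> of an open set \<open>U\<close> is a union of translates of \<open>U\<close>.\<close>

lemma open_map_coset:
  assumes N: "subgroup N G"
  shows "open_map T (factor_topology G T N) (\<lambda>g. N #> g)"
  unfolding open_map_def
proof (intro allI impI)
  fix U assume U: "openin T U"
  have sub: "U \<subseteq> carrier G"
    using openin_subset[OF U] by (simp add: topspace_eq)
  have NG: "N \<subseteq> carrier G" using N by (rule subgroup.subset)
  have "{x \<in> carrier G. N #> x \<in> (\<lambda>g. N #> g) ` U}
      = (\<Union>n\<in>N. {x \<in> topspace T. n \<otimes> x \<in> U})" (is "?L = ?R")
  proof (intro equalityI subsetI)
    fix x assume "x \<in> ?L"
    then obtain u where u: "x \<in> carrier G" "u \<in> U" "N #> u = N #> x" by auto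
    then have "u \<otimes> inv x \<in> N"
      using coset_eq_iff[OF N, of u x] sub by blast
    moreover have "(u \<otimes> inv x) \<otimes> x = u"
      using u sub by (simp add: m_assoc subsetD)
    ultimately show "x \<in> ?R"
      using u by (auto simp: topspace_eq intro!: bexI[of _ "u \<otimes> inv x"])
  next
    fix x assume "x \<in> ?R"
    then obtain n where n: "n \<in> N" "x \<in> carrier G" "n \<otimes> x \<in> U"
      by (auto simp: topspace_eq)
    then have "N #> (n \<otimes> x) = N #> x"
      using NG by (subst coset_eq_iff[OF N]) (auto simp: m_assoc)
    then show "x \<in> ?L"
      using n by (auto intro!: image_eqI[of _ _ "n \<otimes> x"])
  qed
  moreover have "openin T {x \<in> topspace T. n \<otimes> x \<in> U}" if "n \<in> N" for n
    using openin_continuous_map_preimage[OF continuous_map_translation U] that NG by blast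
  ultimately show "openin (factor_topology G T N) ((\<lambda>g. N #> g) ` U)"
    using sub by (auto simp: factor_topology_def openin_quotient_topology topspace_eq)
qed

text \<open>As the coset map \<open>q\<close> is open, \<open>q \<times> q\<close> is again a quotient map. Continuity of the operations
  can therefore be tested on \<open>G\<close>, and the diagonal of \<open>G/N\<close> is closed because its preimage
  \<open>{(x, y). x y\<inverse> \<in> N}\<close> is.\<close>

lemma topological_group_factor:
  assumes N: "N \<lhd> G" and cl: "closedin T N"
  shows "topological_group (G Mod N) (factor_topology G T N)"
proof -
  interpret normal N G by (rule N)
  let ?q = "\<lambda>g. N #> g" and ?F = "factor_topology G T N"
  let ?qq = "\<lambda>(x, y). (N #> x, N #> y)"
  have sg: "subgroup N G" using N by (rule normal_imp_subgroup)
  have topF: "topspace ?F = ?q ` carrier G"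
    by (simp add: topspace_factor_topology carrier_FactGroup)
  have "continuous_map (prod_topology T T) (prod_topology ?F ?F) ?qq"
    by (simp add: continuous_map_prod_top continuous_map_coset)
  then have qq: "quotient_map (prod_topology T T) (prod_topology ?F ?F) ?qq"
    by (rule continuous_open_imp_quotient_map[OF _ open_map_prod_topology])
      (auto simp: open_map_coset[OF sg] topF topspace_eq)
  have "continuous_map (prod_topology T T) ?F (?q \<circ> (\<lambda>(x, y). x \<otimes> y))"
    by (rule continuous_map_compose[OF continuous_mult continuous_map_coset])
  then have "continuous_map (prod_topology T T) ?F ((\<lambda>(X, Y). X \<otimes>\<^bsub>G Mod N\<^esub> Y) \<circ> ?qq)"
    by (rule continuous_map_eq) (auto simp: topspace_eq rcos_sum)
  then have mult: "continuous_map (prod_topology ?F ?F) ?F (\<lambda>(X, Y). X \<otimes>\<^bsub>G Mod N\<^esub> Y)"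
    by (rule continuous_compose_quotient_map[OF qq])
  have "continuous_map T ?F (?q \<circ> (\<lambda>x. inv x))"
    by (rule continuous_map_compose[OF continuous_inv continuous_map_coset])
  then have "continuous_map T ?F ((\<lambda>X. inv\<^bsub>G Mod N\<^esub> X) \<circ> ?q)"
    by (rule continuous_map_eq) (auto simp: topspace_eq carrier_FactGroup inv_FactGroup rcos_inv)
  then have inv: "continuous_map ?F ?F (\<lambda>X. inv\<^bsub>G Mod N\<^esub> X)"
    by (rule continuous_compose_quotient_map[OF quotient_map_coset])
  have "continuous_map (prod_topology T T) (prod_topology T T) (\<lambda>(x, y). (x, inv y))"
    using continuous_inv by (simp add: continuous_map_prod_top)
  from continuous_map_compose[OF this continuous_mult]
  have "closedin (prod_topology T T)
      {p \<in> topspace (prod_topology T T). ((\<lambda>(x, y). x \<otimes> y) \<circ> (\<lambda>(x, y). (x, inv y))) p \<in> N}"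
    using cl by (rule closedin_continuous_map_preimage)
  also have "{p \<in> topspace (prod_topology T T).
        ((\<lambda>(x, y). x \<otimes> y) \<circ> (\<lambda>(x, y). (x, inv y))) p \<in> N}
      = {p \<in> topspace (prod_topology T T). ?qq p \<in> (\<lambda>X. (X, X)) ` topspace ?F}"
  proof (intro Collect_cong conj_cong refl)
    fix p assume "p \<in> topspace (prod_topology T T)"
    then obtain x y where p: "p = (x, y)" and xy: "x \<in> carrier G" "y \<in> carrier G"
      by (auto simp: topspace_eq)
    have "?qq p \<in> (\<lambda>X. (X, X)) ` topspace ?F \<longleftrightarrow> N #> x = N #> y"
      using xy by (simp add: p topF image_iff) metis
    then show "((\<lambda>(x, y). x \<otimes> y) \<circ> (\<lambda>(x, y). (x, inv y))) p \<in> N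
        \<longleftrightarrow> ?qq p \<in> (\<lambda>X. (X, X)) ` topspace ?F"
      by (simp add: p coset_eq_iff[OF sg xy])
  qed
  finally have pre: "closedin (prod_topology T T)
      {p \<in> topspace (prod_topology T T). ?qq p \<in> (\<lambda>X. (X, X)) ` topspace ?F}" .
  have "(\<lambda>X. (X, X)) ` topspace ?F \<subseteq> topspace (prod_topology ?F ?F)"
    by auto
  from qq[unfolded quotient_map_closedin, THEN conjunct2, rule_format, OF this] pre
  have "closedin (prod_topology ?F ?F) ((\<lambda>X. (X, X)) ` topspace ?F)"
    by (rule iffD1)
  then have "Hausdorff_space ?F"
    by (simp add: Hausdorff_space_closedin_diagonal)
  with mult inv show ?thesis
    by (intro topological_group.intro factorgroup_is_group topological_group_axioms.intro)
      (simp_all add: topspace_factor_topology)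
qed

section \<open>Saturated neighbourhoods\<close>

text \<open>A basic open set of the product restricts only finitely many coordinates. If \<open>N \<in> \<N>\<close> is
  contained in these finitely many subgroups, then every restricted coordinate of \<open>g\<close> depends
  only on the coset \<open>Ng\<close>, so the trace of the basic open set on \<open>G\<close> is \<open>N\<close>-saturated.\<close>

lemma saturated_open_neighbourhood:
  assumes fb: "subgroup_filter_base G \<N>"
    and emb: "embedding_map T (product_topology (factor_topology G T) \<N>) (\<lambda>g. \<lambda>N\<in>\<N>. N #> g)"
    and V: "openin T V" and x: "x \<in> V"
  obtains N U where "N \<in> \<N>" "openin T U" "x \<in> U" "U \<subseteq> V"
    "\<And>u y. u \<in> U \<Longrightarrow> y \<in> carrier G \<Longrightarrow> N #> y = N #> u \<Longrightarrow> y \<in> U"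
proof -
  let ?f = "\<lambda>g. \<lambda>N\<in>\<N>. N #> g" and ?P = "product_topology (factor_topology G T) \<N>"
  have hm: "homeomorphic_map T (subtopology ?P (?f ` topspace T)) ?f"
    using emb unfolding embedding_map_def .
  have "openin (subtopology ?P (?f ` topspace T)) (?f ` V)"
    using homeomorphic_imp_open_map[OF hm] V unfolding open_map_def by blast
  then obtain W where W: "openin ?P W" "?f ` V = W \<inter> ?f ` topspace T"
    by (auto simp: openin_subtopology)
  then have "?f x \<in> W" using x by blast
  with W(1) have "\<exists>B. finite {M \<in> \<N>. B M \<noteq> topspace (factor_topology G T M)} \<and>
      (\<forall>M\<in>\<N>. openin (factor_topology G T M) (B M)) \<and> ?f x \<in> Pi\<^sub>E \<N> B \<and> Pi\<^sub>E \<N> B \<subseteq> W"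
    unfolding openin_product_topology_alt by (rule bspec)
  then obtain B where fin: "finite {M \<in> \<N>. B M \<noteq> topspace (factor_topology G T M)}"
    and B: "\<forall>M\<in>\<N>. openin (factor_topology G T M) (B M)"
    and xB: "?f x \<in> Pi\<^sub>E \<N> B" and BW: "Pi\<^sub>E \<N> B \<subseteq> W"
    by (elim exE conjE)
  define F where "F = {M \<in> \<N>. B M \<noteq> topspace (factor_topology G T M)}"
  define U where "U = {y \<in> topspace T. ?f y \<in> Pi\<^sub>E \<N> B}"
  have subg: "subgroup M G" if "M \<in> \<N>" for M
    using fb that unfolding subgroup_filter_base_def by blast
  have "finite F" "F \<subseteq> \<N>"
    using fin by (auto simp: F_def)
  then have "\<exists>N\<in>\<N>. \<forall>M\<in>F. N \<subseteq> M"
  proof (induction F rule: finite_induct)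
    case empty
    then show ?case using fb unfolding subgroup_filter_base_def by blast
  next
    case (insert M F)
    then obtain N where "N \<in> \<N>" "\<forall>M\<in>F. N \<subseteq> M" by auto
    moreover obtain N' where "N' \<in> \<N>" "N' \<subseteq> N \<inter> M"
      using fb insert.prems \<open>N \<in> \<N>\<close> unfolding subgroup_filter_base_def by blast
    ultimately show ?case by blast
  qed
  then obtain N where N: "N \<in> \<N>" "\<And>M. M \<in> F \<Longrightarrow> N \<subseteq> M" by blast
  have "openin ?P (Pi\<^sub>E \<N> B)"
    using fin B by (simp add: openin_PiE_gen)
  moreover have "continuous_map T ?P ?f"
    by (auto simp: continuous_map_componentwise continuous_map_coset)
  ultimately have openU: "openin T U"
    unfolding U_def by (rule openin_continuous_map_preimage[rotated])
  have "U \<subseteq> V"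
  proof
    fix y assume "y \<in> U"
    then have y: "y \<in> topspace T" and "?f y \<in> W"
      using BW unfolding U_def by blast+
    then have "?f y \<in> ?f ` V"
      unfolding W(2) by (intro IntI imageI)
    then show "y \<in> V"
      using inj_on_image_mem_iff[OF homeomorphic_imp_injective_map[OF hm] y openin_subset[OF V]]
      by simp
  qed
  have "y \<in> U" if u: "u \<in> U" and y: "y \<in> carrier G" and eq: "N #> y = N #> u" for u y
  proof -
    have uG: "u \<in> carrier G" using u by (simp add: U_def topspace_eq)
    have "M #> y \<in> B M" if M: "M \<in> \<N>" for M
    proof (cases "M \<in> F")
      case True
      have "y \<otimes> inv u \<in> M"
        using coset_eq_iff[OF subg[OF N(1)] y uG] eq N(2)[OF True] by blast
      then have "M #> y = M #> u"
        using coset_eq_iff[OF subg[OF M] y uG] by blast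
      then show ?thesis
        using u M by (auto simp: U_def PiE_iff)
    next
      case False
      then show ?thesis
        using M y by (auto simp: F_def topspace_factor_topology carrier_FactGroup)
    qed
    then show ?thesis
      using y by (auto simp: U_def topspace_eq)
  qed
  moreover have "x \<in> U"
    using x xB openin_subset[OF V] by (auto simp: U_def)
  ultimately show thesis
    using that N(1) openU \<open>U \<subseteq> V\<close> by blast
qed

end

section \<open>Openness of a homomorphism from openness modulo subgroups\<close>

lemma image_coset:
  assumes "\<phi> \<in> hom G H" "N \<subseteq> carrier G" "x \<in> carrier G"
  shows "\<phi> ` (N #>\<^bsub>G\<^esub> x) = \<phi> ` N #>\<^bsub>H\<^esub> \<phi> x"
  using assms by (auto simp: r_coset_def image_iff hom_mult subset_iff)

text \<open>The map that \<open>\<phi>\<close> induces from \<open>G/N\<close> to \<open>H/\<phi>(N)\<close> sends a coset to its image under \<open>\<phi>\<close>, so it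
  is \<open>(`) \<phi>\<close>. Its openness controls \<open>\<phi>(U)\<phi>(N) = \<phi>(UN)\<close>, which is \<open>\<phi>(U)\<close> itself
  when \<open>U\<close> is \<open>N\<close>-saturated, and such sets \<open>U\<close> form a base.\<close>

lemma open_map_if_induced_maps_open:
  assumes G: "topological_group G T" and H: "topological_group H T'"
    and fb: "subgroup_filter_base G \<N>"
    and emb: "embedding_map T (product_topology (factor_topology G T) \<N>) (\<lambda>g. \<lambda>N\<in>\<N>. N #>\<^bsub>G\<^esub> g)"
    and hom: "\<phi> \<in> hom G H"
    and ind: "\<And>N. N \<in> \<N> \<Longrightarrow>
      open_map (factor_topology G T N) (factor_topology H T' (\<phi> ` N)) ((`) \<phi>)"
  shows "open_map T T' \<phi>"
  unfolding open_map_def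
proof (intro allI impI)
  interpret G: topological_group G T by (rule G)
  interpret H: topological_group H T' by (rule H)
  interpret group_hom G H \<phi>
    by (simp add: group_hom_def group_hom_axioms_def hom)
  fix V assume V: "openin T V"
  show "openin T' (\<phi> ` V)"
  proof (subst openin_subopen, intro ballI)
    fix z assume "z \<in> \<phi> ` V"
    then obtain x where x: "x \<in> V" "z = \<phi> x" by blast
    obtain N U where N: "N \<in> \<N>" and U: "openin T U" "x \<in> U" "U \<subseteq> V"
      and sat: "\<And>u y. u \<in> U \<Longrightarrow> y \<in> carrier G \<Longrightarrow> N #>\<^bsub>G\<^esub> y = N #>\<^bsub>G\<^esub> u \<Longrightarrow> y \<in> U"
      using G.saturated_open_neighbourhood[OF fb emb V x(1)] by metis
    have sg: "subgroup N G" using fb N by (simp add: subgroup_filter_base_def)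
    then have NG: "N \<subseteq> carrier G" by (rule subgroup.subset)
    have sH: "subgroup (\<phi> ` N) H" using sg by (rule subgroup_img_is_subgroup)
    have UG: "U \<subseteq> carrier G"
      using openin_subset[OF U(1)] by (simp add: G.topspace_eq)
    have "openin (factor_topology H T' (\<phi> ` N)) ((`) \<phi> ` (\<lambda>g. N #>\<^bsub>G\<^esub> g) ` U)"
      using ind[OF N] G.open_map_coset[OF sg] U(1) unfolding open_map_def by blast
    then have "openin T'
        {y \<in> topspace T'. \<phi> ` N #>\<^bsub>H\<^esub> y \<in> (`) \<phi> ` (\<lambda>g. N #>\<^bsub>G\<^esub> g) ` U}"
      by (rule openin_continuous_map_preimage[OF H.continuous_map_coset])
    also have "{y \<in> topspace T'. \<phi> ` N #>\<^bsub>H\<^esub> y \<in> (`) \<phi> ` (\<lambda>g. N #>\<^bsub>G\<^esub> g) ` U} = \<phi> ` U"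
      (is "?L = _")
    proof (intro equalityI subsetI)
      fix y assume "y \<in> ?L"
      then obtain u where y: "y \<in> carrier H" and u: "u \<in> U"
        and eq: "\<phi> ` N #>\<^bsub>H\<^esub> y = \<phi> ` (N #>\<^bsub>G\<^esub> u)"
        by (auto simp: H.topspace_eq)
      \<comment> \<open>\<open>y\<close> lies in its own coset; saturation moves the preimage found there into \<open>U\<close>\<close>
      have "y \<in> \<phi> ` (N #>\<^bsub>G\<^esub> u)"
        using H.rcos_self[OF y sH] eq by simp
      then obtain w where w: "w \<in> N #>\<^bsub>G\<^esub> u" "y = \<phi> w" by blast
      have "N #>\<^bsub>G\<^esub> w = N #>\<^bsub>G\<^esub> u"
        using G.repr_independence[OF w(1) _ sg] u UG by blast
      then have "w \<in> U"
        using sat[OF u, of w] w(1) G.r_coset_subset_G[OF NG] u UG by blast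
      with w show "y \<in> \<phi> ` U" by blast
    next
      fix y assume "y \<in> \<phi> ` U"
      then obtain u where u: "u \<in> U" "y = \<phi> u" by blast
      then have "\<phi> ` N #>\<^bsub>H\<^esub> y = \<phi> ` (N #>\<^bsub>G\<^esub> u)"
        using image_coset[OF hom NG, of u] UG by auto
      then show "y \<in> ?L"
        using u UG by (auto simp: H.topspace_eq)
    qed
    finally show "\<exists>S. openin T' S \<and> z \<in> S \<and> S \<subseteq> \<phi> ` V"
      using U x by blast
  qed
qed

lemma closedin_image_h_complete_subgroup:
  assumes G: "topological_group G T" and H: "topological_group H T'" and N: "subgroup N G"
    and hc: "h_complete (G\<lparr>carrier := N\<rparr>) (subtopology T N)"
    and hom: "\<phi> \<in> hom G H" and cont: "continuous_map T T' \<phi>"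
  shows "closedin T' (\<phi> ` N)"
proof -
  have "\<phi> \<in> hom (G\<lparr>carrier := N\<rparr>) H"
    using hom subgroup.subset[OF N] by (auto simp: hom_def)
  from h_complete_any_type[OF topological_group_subgroup[OF G N] hc H this
      continuous_map_from_subtopology[OF cont]]
  show ?thesis by simp
qed

lemma induced_map_continuous_surjective_hom:
  assumes G: "topological_group G T" and H: "topological_group H T'" and N: "N \<lhd> G"
    and hom: "\<phi> \<in> hom G H" and cont: "continuous_map T T' \<phi>" and surj: "\<phi> ` carrier G = carrier H"
  shows "(`) \<phi> \<in> hom (G Mod N) (H Mod \<phi> ` N)"
    and "continuous_map (factor_topology G T N) (factor_topology H T' (\<phi> ` N)) ((`) \<phi>)"
    and "(`) \<phi> ` carrier (G Mod N) = carrier (H Mod \<phi> ` N)"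
proof -
  interpret G: topological_group G T by (rule G)
  interpret H: topological_group H T' by (rule H)
  interpret gh: group_hom G H \<phi>
    by (simp add: group_hom_def group_hom_axioms_def hom)
  interpret N: normal N G by (rule N)
  interpret K: normal "\<phi> ` N" H
    using N.surj_hom_normal_subgroup[OF gh.group_hom_axioms surj] .
  have im: "\<phi> ` (N #>\<^bsub>G\<^esub> x) = \<phi> ` N #>\<^bsub>H\<^esub> \<phi> x" if "x \<in> carrier G" for x
    using image_coset[OF hom N.subset that] .
  show "(`) \<phi> ` carrier (G Mod N) = carrier (H Mod \<phi> ` N)"
    unfolding carrier_FactGroup surj[symmetric] image_image by (simp add: im)
  then show "(`) \<phi> \<in> hom (G Mod N) (H Mod \<phi> ` N)"
  proof (intro homI)
    fix X Y assume "X \<in> carrier (G Mod N)" "Y \<in> carrier (G Mod N)"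
    then obtain x y where "x \<in> carrier G" "y \<in> carrier G" "X = N #>\<^bsub>G\<^esub> x" "Y = N #>\<^bsub>G\<^esub> y"
      by (auto simp: carrier_FactGroup)
    then show "\<phi> ` (X \<otimes>\<^bsub>G Mod N\<^esub> Y) = \<phi> ` X \<otimes>\<^bsub>H Mod \<phi> ` N\<^esub> \<phi> ` Y"
      by (simp add: im N.rcos_sum K.rcos_sum)
  qed blast
  have "continuous_map T (factor_topology H T' (\<phi> ` N)) ((\<lambda>y. \<phi> ` N #>\<^bsub>H\<^esub> y) \<circ> \<phi>)"
    by (rule continuous_map_compose[OF cont H.continuous_map_coset])
  then have "continuous_map T (factor_topology H T' (\<phi> ` N)) ((`) \<phi> \<circ> (\<lambda>x. N #>\<^bsub>G\<^esub> x))"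
    by (rule continuous_map_eq) (simp add: im G.topspace_eq)
  then show "continuous_map (factor_topology G T N) (factor_topology H T' (\<phi> ` N)) ((`) \<phi>)"
    by (rule continuous_compose_quotient_map[OF G.quotient_map_coset])
qed

section \<open>Minimality and total minimality\<close>

theorem theorem3p3:
  fixes G :: "('a, 'm) monoid_scheme" and T :: "'a topology" and \<N> :: "'a set set"
  assumes "topological_group G T"
    and "subgroup_filter_base G \<N>"
    and "\<forall>N \<in> \<N>. N \<lhd> G"
    and "\<forall>N \<in> \<N>. h_complete (G\<lparr>carrier := N\<rparr>) (subtopology T N)"
    and "embedding_map T (product_topology (factor_topology G T) \<N>) (\<lambda>g. \<lambda>N\<in>\<N>. N #>\<^bsub>G\<^esub> g)"
  shows "((\<forall>N \<in> \<N>. minimal_group (G Mod N) (factor_topology G T N)) \<longrightarrow> minimal_group G T) \<and>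
    ((\<forall>N \<in> \<N>. totally_minimal (G Mod N) (factor_topology G T N)) \<longrightarrow> totally_minimal G T)"
proof -
  note G = assms(1) and fb = assms(2) and emb = assms(5)
  interpret G: topological_group G T by (rule G)
  have nml: "N \<lhd> G" and sg: "subgroup N G"
    and hc: "h_complete (G\<lparr>carrier := N\<rparr>) (subtopology T N)" if "N \<in> \<N>" for N
    using that assms(3,4) normal_imp_subgroup by blast+
  have "minimal_group G T" if min: "\<forall>N \<in> \<N>. minimal_group (G Mod N) (factor_topology G T N)"
  proof -
    have "T' = T" if T': "topological_group G T'" and coarser: "\<forall>U. openin T' U \<longrightarrow> openin T U" for T'
    proof -
      interpret T': topological_group G T' by (rule T')
      have id_hom: "(\<lambda>x. x) \<in> hom G G" by (simp add: hom_def)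
      have id_cont: "continuous_map T T' (\<lambda>x. x)"
        unfolding continuous_map_def
      proof (intro conjI allI impI)
        fix U assume U: "openin T' U"
        then have "{x \<in> topspace T. x \<in> U} = U"
          using openin_subset[OF U] by (auto simp: G.topspace_eq T'.topspace_eq)
        then show "openin T {x \<in> topspace T. x \<in> U}"
          using coarser U by simp
      qed (simp add: G.topspace_eq T'.topspace_eq)
      have "open_map (factor_topology G T N) (factor_topology G T' ((\<lambda>x. x) ` N)) ((`) (\<lambda>x. x))"
        if N: "N \<in> \<N>" for N
      proof -
        have "closedin T' N"
          using closedin_image_h_complete_subgroup[OF G T' sg[OF N] hc[OF N] id_hom id_cont] by simp
        then have "topological_group (G Mod N) (factor_topology G T' N)"
          by (rule T'.topological_group_factor[OF nml[OF N]])
        moreover have "\<forall>U. openin (factor_topology G T' N) U \<longrightarrow> openin (factor_topology G T N) U"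
          using coarser
          by (simp add: factor_topology_def openin_quotient_topology G.topspace_eq T'.topspace_eq)
        \<comment> \<open>so both topologies on \<open>G/N\<close> agree, and the induced map is the identity of one space\<close>
        ultimately have "factor_topology G T' N = factor_topology G T N"
          using min N unfolding minimal_group_def by blast
        then show ?thesis by (simp add: open_map_def)
      qed
      then have "open_map T T' (\<lambda>x. x)"
        by (intro open_map_if_induced_maps_open[OF G T' fb emb id_hom]) simp_all
      then show ?thesis
        using coarser by (auto simp: open_map_def topology_eq)
    qed
    then show ?thesis
      unfolding minimal_group_def by blast
  qed
  moreover have "totally_minimal G T"
    if tm: "\<forall>N \<in> \<N>. totally_minimal (G Mod N) (factor_topology G T N)"
    unfolding totally_minimal_def
  proof (intro allI impI ballI, elim conjE)
    fix H :: "'a monoid" and T' \<phi>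
    assume H: "topological_group H T'" and hom: "\<phi> \<in> hom G H"
      and cont: "continuous_map T T' \<phi>" and surj: "\<phi> ` carrier G = carrier H"
    interpret H: topological_group H T' by (rule H)
    have gh: "group_hom G H \<phi>"
      by (simp add: group_hom_def group_hom_axioms_def hom)
    have "open_map (factor_topology G T N) (factor_topology H T' (\<phi> ` N)) ((`) \<phi>)"
      if N: "N \<in> \<N>" for N
    proof (rule totally_minimal_any_type)
      \<comment> \<open>the identity of \<open>G\<close> embeds the \<open>h\<close>-complete group \<open>N\<close>, so \<open>G/N\<close> is Hausdorff\<close>
      have "closedin T N"
        using closedin_image_h_complete_subgroup[OF G G sg[OF N] hc[OF N], of "\<lambda>x. x"]
        by (simp add: hom_def)
      then show "topological_group (G Mod N) (factor_topology G T N)"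
        by (rule G.topological_group_factor[OF nml[OF N]])
      have "closedin T' (\<phi> ` N)"
        by (rule closedin_image_h_complete_subgroup[OF G H sg[OF N] hc[OF N] hom cont])
      then show "topological_group (H Mod \<phi> ` N) (factor_topology H T' (\<phi> ` N))"
        by (rule H.topological_group_factor[OF normal.surj_hom_normal_subgroup[OF nml[OF N] gh surj]])
      show "totally_minimal (G Mod N) (factor_topology G T N)"
        using tm N by blast
    qed (use induced_map_continuous_surjective_hom[OF G H nml[OF N] hom cont surj] in auto)
    then show "open_map T T' \<phi>"
      by (rule open_map_if_induced_maps_open[OF G H fb emb hom])
  qed
  ultimately show ?thesis by blast
qed

end
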